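(* Let $(G,K)$ be a hypergroup Gelfand pair, let $\gamma:\widehat{G^\natural}\to\mathbb{R}_+=[0,\infty)$ be a measurable function and let $s>0$ be a real number. Assume that $\widehat{G^\natural}$ is uniformly bounded and that $\frac{1}{1+\gamma(\cdot)^2}\in L^s(\widehat{G^\natural},\pi)$. Then there exists a constant $C(\gamma,s)>0$ such that $$\|f\|_\infty\leqslant C(\gamma,s)\,\|f\|_{H^{s,\natural}_\gamma}\qquad\text{for all } f\in H^{s,\natural}_\gamma(G).$$
   Context: Hypergroups. Let $G$ be a locally compact Hausdorff space, $M(G)$ its Radon measures, $M_b(G)$ the bounded Radon measures, $\delta_x$ the point mass at $x$, and $\mathfrak{C}(G)$ the set of compact subspaces of $G$ with the Michael topology. $G$ is a hypergroup if: (1) there is a binary operation $\ast$ (convolution) turning $M_b(G)$ into an associative algebra such that $(\mu,\nu)\mapsto\mu\ast\nu$ is continuous for the cone topology (on nonnegative bounded measures, the weakest topology making $\mu\mapsto\int f\,d\mu$ continuous for $f=1$ and for every continuous compactly supported $f$), $\delta_x\ast\delta_y$ is a probability measure with compact support for all $x,y\in G$, and $(x,y)\mapsto\mathrm{supp}(\delta_x\ast\delta_y)$ is continuous from $G\times G$ to $\mathfrak{C}(G)$; (2) there is a unique $e\in G$ with $\delta_x\ast\delta_e=\delta_e\ast\delta_x=\delta_x$ for all $x$; (3) there is an involutive homeomorphism $x\mapsto x^\diamond$ of $G$ with $(\delta_x\ast\delta_y)^\diamond=\delta_{y^\diamond}\ast\delta_{x^\diamond}$, where $\mu^\diamond(f)=\mu(f^\diamond)$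 and $f^\diamond(x)=f(x^\diamond)$; (4) $z\in\mathrm{supp}(\delta_x\ast\delta_y)\iff x\in\mathrm{supp}(\delta_z\ast\delta_{y^\diamond})$. A subhypergroup is a nonempty closed subset $H$ with $x^\diamond\in H$ and $\mathrm{supp}(\delta_x\ast\delta_y)\subset H$ for all $x,y\in H$. Write $f(x\ast y)=\int_G f\,d(\delta_x\ast\delta_y)$, and similarly for more factors; for measures, $(\mu\ast\nu)(f)=\int_G\int_G f(x\ast y)\,d\mu(x)\,d\nu(y)$. Gelfand pairs. $G$ is assumed to carry a left Haar measure $dx$ (a nonzero nonnegative Radon measure with $\int_G f(y\ast x)\,dx=\int_G f(x)\,dx$ for all $y\in G$ and all continuous compactly supported $f$), and $K$ is a compact subhypergroup of $G$ with normalized Haar measure $dk$. A function $f$ is $K$-bi-invariant if $f(k_1\ast x\ast k_2)=f(x)$ for all $k_1,k_2\in K$, $x\in G$ (for $L^p$ functions, understood almost everywhere in $x$). Put $f^\natural(x)=\int_K\int_K f(k_1\ast x\ast k_2)\,dk_1\,dk_2$; a measure $\mu$ is $K$-bi-invariant if $\mu(f^\natural)=\mu(f)$ for all continuous compactly supported $f$. $M_c^\natural(G)$ is the set of compactly supported $K$-bi-invariant complex Radon measures. $(G,K)$ is a (hypergroup) Gelfand pair if $(M_c^\natural(G),\ast)$ is commutative. Dual and Fourier transform. $\widehat{G^\natural}$ is the set of bounded continuous $K$-bi-invariant functions $\phi:G\to\mathbb{C}$ with $\phi(e)=1$, $\int_K\phi(x\ast k\ast y)\,dk=\phi(x)\phi(y)$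 and $\phi(x^\diamond)=\overline{\phi(x)}$ for all $x,y\in G$, with the topology of uniform convergence on compact sets (it is locally compact Hausdorff). For a $K$-bi-invariant integrable $f$, $\widehat f(\phi)=\int_G\phi(x^\diamond)f(x)\,dx$ for $\phi\in\widehat{G^\natural}$. $\pi$ denotes the Plancherel measure: the unique nonnegative measure on $\widehat{G^\natural}$ such that $\int_G|f(x)|^2dx=\int_{\widehat{G^\natural}}|\widehat f(\phi)|^2d\pi(\phi)$ for all $K$-bi-invariant $f\in L^1(G)\cap L^2(G)$. Let $L^{2,\natural}(G)$ be the space of $K$-bi-invariant functions in $L^2(G)$ and $L^2(\widehat{G^\natural})=L^2(\widehat{G^\natural},\pi)$. It is a known fact that the Fourier transform extends to an isometric isomorphism, still written $f\mapsto\widehat f$, from $L^{2,\natural}(G)$ onto $L^2(\widehat{G^\natural})$. The inverse Fourier transform is $f(x)=\int_{\widehat{G^\natural}}\phi(x)\widehat f(\phi)\,d\pi(\phi)$; an $f\in L^{2,\natural}(G)$ with $\widehat f\in L^1(\widehat{G^\natural},\pi)$ is identified with the representative of its almost-everywhere class given by this formula. Sobolev space. $H^{s,\natural}_\gamma(G)=\{f\in L^{2,\natural}(G):\int_{\widehat{G^\natural}}(1+\gamma(\phi)^2)^s|\widehat f(\phi)|^2d\pi(\phi)<\infty\}$, with norm $\|f\|_{H^{s,\natural}_\gamma}=\left(\int_{\widehat{G^\natural}}(1+\gamma(\phi)^2)^s|\widehat f(\phi)|^2d\pi(\phi)\right)^{1/2}$. Other conventions. $\widehat{G^\natural}$ is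 uniformly bounded if there is a real $M$ with $|\phi(x)|\leqslant M$ for all $x\in G$ and all $\phi\in\widehat{G^\natural}$. $h\in L^s(\widehat{G^\natural},\pi)$ means $h$ is measurable and $\int_{\widehat{G^\natural}}|h|^s\,d\pi<\infty$ (any real $s>0$). $\|f\|_\infty$ is the supremum norm of $f$ on $G$. *)

theory Defs
  imports "HOL-Analysis.Analysis"
begin

section \<open>Radon measures\<close>

definition borel_of :: "'x topology \<Rightarrow> 'x measure" where
  "borel_of X = sigma (topspace X) {U. openin X U}"

definition radon_measure :: "'x topology \<Rightarrow> 'x measure \<Rightarrow> bool" where
  "radon_measure X \<mu> \<longleftrightarrow>
     sets \<mu> = sets (borel_of X) \<and>
     (\<forall>C. compactin X C \<longrightarrow> emeasure \<mu> C < \<infinity>) \<and>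
     (\<forall>A\<in>sets \<mu>. emeasure \<mu> A = (INF U\<in>{U. openin X U \<and> A \<subseteq> U}. emeasure \<mu> U)) \<and>
     (\<forall>U. openin X U \<longrightarrow> emeasure \<mu> U = (SUP C\<in>{C. compactin X C \<and> C \<subseteq> U}. emeasure \<mu> C))"

text \<open>A complex measure is a countably additive complex-valued function on the Borel sets, extended
  by \<open>0\<close> to the other subsets so that two complex measures are equal iff they are equal as functions.\<close>

type_synonym 'a cmeas = "'a set \<Rightarrow> complex"

definition complex_measure :: "'a::topological_space cmeas \<Rightarrow> bool" where
  "complex_measure \<mu> \<longleftrightarrow>
     (\<forall>A. A \<notin> sets borel \<longrightarrow> \<mu> A = 0) \<and>
     (\<forall>A :: nat \<Rightarrow> 'a set. range A \<subseteq> sets borel \<longrightarrow> disjoint_family A \<longrightarrow>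
        (\<lambda>n. \<mu> (A n)) sums \<mu> (\<Union>n. A n))"

definition total_variation :: "'a::topological_space cmeas \<Rightarrow> 'a measure" where
  "total_variation \<mu> = measure_of UNIV (sets borel)
     (\<lambda>A. SUP P\<in>{P. finite P \<and> P \<subseteq> sets borel \<and> disjoint P \<and> \<Union>P = A}.
            \<Sum>E\<in>P. ennreal (norm (\<mu> E)))"

text \<open>The space \<open>M\<^sub>b(G)\<close>.\<close>

definition bounded_radon :: "'a::topological_space cmeas set" where
  "bounded_radon = {\<mu>. complex_measure \<mu> \<and> radon_measure euclidean (total_variation \<mu>)}"

definition bounded_radon_nonneg :: "'a::topological_space cmeas set" where
  "bounded_radon_nonneg = {\<mu>\<in>bounded_radon. \<forall>A. \<mu> A \<in> \<real>\<^sub>\<ge>\<^sub>0}"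

definition point_mass :: "'a::topological_space \<Rightarrow> 'a cmeas" where
  "point_mass x = (\<lambda>A. if A \<in> sets borel then indicator A x else 0)"

definition csupport :: "'a::topological_space cmeas \<Rightarrow> 'a set" where
  "csupport \<mu> = {x. \<forall>U. open U \<and> x \<in> U \<longrightarrow> emeasure (total_variation \<mu>) U \<noteq> 0}"

text \<open>The positive part in the Jordan decomposition of a real measure \<open>\<nu>\<close>. Negative values of \<open>\<nu>\<close>
  are truncated by \<^const>\<open>ennreal\<close>, and \<open>B = {}\<close> always contributes \<open>0\<close>.\<close>

definition jordan_pos :: "('a::topological_space set \<Rightarrow> real) \<Rightarrow> 'a measure" where
  "jordan_pos \<nu> = measure_of UNIV (sets borel)
     (\<lambda>A. SUP B\<in>{B\<in>sets borel. B \<subseteq> A}. ennreal (\<nu> B))"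

definition cintegral :: "'a::topological_space cmeas \<Rightarrow> ('a \<Rightarrow> complex) \<Rightarrow> complex" where
  "cintegral \<mu> f =
     (LINT x|jordan_pos (\<lambda>A. Re (\<mu> A)). f x) - (LINT x|jordan_pos (\<lambda>A. - Re (\<mu> A)). f x)
     + \<i> * ((LINT x|jordan_pos (\<lambda>A. Im (\<mu> A)). f x) - (LINT x|jordan_pos (\<lambda>A. - Im (\<mu> A)). f x))"

definition Cc :: "('a::topological_space \<Rightarrow> complex) set" where
  "Cc = {f. continuous_on UNIV f \<and> compact (closure {x. f x \<noteq> 0})}"

definition cone_topology :: "'a::topological_space cmeas topology" where
  "cone_topology = topology_generated_by
     {{\<mu>\<in>bounded_radon_nonneg. cintegral \<mu> f \<in> U} | f U. f \<in> insert (\<lambda>_. 1) Cc \<and> open U}"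

text \<open>The points of this space are the nonempty compact sets.\<close>

definition michael_topology :: "'a::topological_space set topology" where
  "michael_topology = topology_generated_by
     {{C. compact C \<and> C \<inter> U \<noteq> {} \<and> C \<subseteq> V} | U V. open U \<and> open V}"

section \<open>Hypergroups\<close>

text \<open>The pushforward under \<open>dia\<close>; it satisfies \<open>\<mu>\<^sup>\<diamond>(f) = \<mu>(f \<circ> dia)\<close>.\<close>

definition cmeas_dia :: "('a \<Rightarrow> 'a) \<Rightarrow> 'a cmeas \<Rightarrow> 'a cmeas" where
  "cmeas_dia dia \<mu> = (\<lambda>A. \<mu> (dia -` A))"

text \<open>The underlying space is the whole type \<open>'a\<close>. Only the values of \<open>conv\<close> on
  \<^const>\<open>bounded_radon\<close> matter. That the convolution of nonnegative measures is nonnegative is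
  part of \<^const>\<open>continuous_map\<close>.\<close>

definition hypergroup :: "('a::t2_space cmeas \<Rightarrow> 'a cmeas \<Rightarrow> 'a cmeas) \<Rightarrow> 'a \<Rightarrow> ('a \<Rightarrow> 'a) \<Rightarrow> bool" where
  "hypergroup conv e dia \<longleftrightarrow>
     locally_compact_space (euclidean :: 'a topology) \<and>
     \<comment> \<open>\<open>M\<^sub>b(G)\<close> is an associative algebra\<close>
     (\<forall>\<mu>\<in>bounded_radon. \<forall>\<nu>\<in>bounded_radon. conv \<mu> \<nu> \<in> bounded_radon) \<and>
     (\<forall>\<mu>\<in>bounded_radon. \<forall>\<nu>\<in>bounded_radon. \<forall>\<rho>\<in>bounded_radon.
        conv (conv \<mu> \<nu>) \<rho> = conv \<mu> (conv \<nu> \<rho>) \<and>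
        conv (\<lambda>A. \<mu> A + \<nu> A) \<rho> = (\<lambda>A. conv \<mu> \<rho> A + conv \<nu> \<rho> A) \<and>
        conv \<rho> (\<lambda>A. \<mu> A + \<nu> A) = (\<lambda>A. conv \<rho> \<mu> A + conv \<rho> \<nu> A)) \<and>
     (\<forall>\<mu>\<in>bounded_radon. \<forall>\<nu>\<in>bounded_radon. \<forall>c.
        conv (\<lambda>A. c * \<mu> A) \<nu> = (\<lambda>A. c * conv \<mu> \<nu> A) \<and>
        conv \<mu> (\<lambda>A. c * \<nu> A) = (\<lambda>A. c * conv \<mu> \<nu> A)) \<and>
     continuous_map (prod_topology cone_topology cone_topology) cone_topology
       (\<lambda>(\<mu>, \<nu>). conv \<mu> \<nu>) \<and>
     (\<forall>x y. conv (point_mass x) (point_mass y) \<in> bounded_radon_nonneg \<and>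
            conv (point_mass x) (point_mass y) UNIV = 1 \<and>
            compact (csupport (conv (point_mass x) (point_mass y)))) \<and>
     continuous_map (prod_topology euclidean euclidean) michael_topology
       (\<lambda>(x, y). csupport (conv (point_mass x) (point_mass y))) \<and>
     \<comment> \<open>identity\<close>
     (\<forall>e'. (\<forall>x. conv (point_mass x) (point_mass e') = point_mass x \<and>
                conv (point_mass e') (point_mass x) = point_mass x) \<longleftrightarrow> e' = e) \<and>
     \<comment> \<open>involution\<close>
     homeomorphic_map euclidean euclidean dia \<and>
     (\<forall>x. dia (dia x) = x) \<and>
     (\<forall>x y. cmeas_dia dia (conv (point_mass x) (point_mass y)) =
            conv (point_mass (dia y)) (point_mass (dia x))) \<and>
     (\<forall>x y z. z \<in> csupport (conv (point_mass x) (point_mass y)) \<longleftrightarrow>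
              x \<in> csupport (conv (point_mass z) (point_mass (dia y))))"

definition subhypergroup ::
    "('a::t2_space cmeas \<Rightarrow> 'a cmeas \<Rightarrow> 'a cmeas) \<Rightarrow> ('a \<Rightarrow> 'a) \<Rightarrow> 'a set \<Rightarrow> bool" where
  "subhypergroup conv dia H \<longleftrightarrow> H \<noteq> {} \<and> closed H \<and> (\<forall>x\<in>H. dia x \<in> H) \<and>
     (\<forall>x\<in>H. \<forall>y\<in>H. csupport (conv (point_mass x) (point_mass y)) \<subseteq> H)"

text \<open>\<open>f(x \<ast> y)\<close> and \<open>f(x \<ast> y \<ast> z)\<close>.\<close>

definition at2 ::
    "('a::t2_space cmeas \<Rightarrow> 'a cmeas \<Rightarrow> 'a cmeas) \<Rightarrow> ('a \<Rightarrow> complex) \<Rightarrow> 'a \<Rightarrow> 'a \<Rightarrow> complex" where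
  "at2 conv f x y = cintegral (conv (point_mass x) (point_mass y)) f"

definition at3 ::
    "('a::t2_space cmeas \<Rightarrow> 'a cmeas \<Rightarrow> 'a cmeas) \<Rightarrow> ('a \<Rightarrow> complex) \<Rightarrow> 'a \<Rightarrow> 'a \<Rightarrow> 'a \<Rightarrow> complex" where
  "at3 conv f x y z = cintegral (conv (conv (point_mass x) (point_mass y)) (point_mass z)) f"

text \<open>A left Haar measure of a closed subhypergroup \<open>H\<close>, regarded as a measure on the whole space
  that vanishes off \<open>H\<close>. Testing with functions on the whole space is enough: by Tietze's theorem they
  restrict onto the compactly supported continuous functions on \<open>H\<close>.\<close>

definition left_haar ::
    "('a::t2_space cmeas \<Rightarrow> 'a cmeas \<Rightarrow> 'a cmeas) \<Rightarrow> 'a set \<Rightarrow> 'a measure \<Rightarrow> bool" where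
  "left_haar conv H m \<longleftrightarrow>
     radon_measure euclidean m \<and> emeasure m (- H) = 0 \<and> emeasure m UNIV \<noteq> 0 \<and>
     (\<forall>y\<in>H. \<forall>f\<in>Cc. (LINT x|m. at2 conv f y x) = (LINT x|m. f x))"

section \<open>Gelfand pairs\<close>

definition bi_invariant ::
    "('a::t2_space cmeas \<Rightarrow> 'a cmeas \<Rightarrow> 'a cmeas) \<Rightarrow> 'a set \<Rightarrow> ('a \<Rightarrow> complex) \<Rightarrow> bool" where
  "bi_invariant conv K f \<longleftrightarrow> (\<forall>k1\<in>K. \<forall>k2\<in>K. \<forall>x. at3 conv f k1 x k2 = f x)"

definition bi_invariant_AE ::
    "('a::t2_space cmeas \<Rightarrow> 'a cmeas \<Rightarrow> 'a cmeas) \<Rightarrow> 'a set \<Rightarrow> 'a measure \<Rightarrow> ('a \<Rightarrow> complex) \<Rightarrow> bool" where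
  "bi_invariant_AE conv K m f \<longleftrightarrow> (\<forall>k1\<in>K. \<forall>k2\<in>K. AE x in m. at3 conv f k1 x k2 = f x)"

definition natural ::
    "('a::t2_space cmeas \<Rightarrow> 'a cmeas \<Rightarrow> 'a cmeas) \<Rightarrow> 'a measure \<Rightarrow> ('a \<Rightarrow> complex) \<Rightarrow> 'a \<Rightarrow> complex" where
  "natural conv mK f x = (LINT k2|mK. LINT k1|mK. at3 conv f k1 x k2)"

text \<open>A compactly supported Radon measure is bounded, so nothing is lost by starting from
  \<^const>\<open>bounded_radon\<close>.\<close>

definition Mc_natural ::
    "('a::t2_space cmeas \<Rightarrow> 'a cmeas \<Rightarrow> 'a cmeas) \<Rightarrow> 'a measure \<Rightarrow> 'a cmeas set" where
  "Mc_natural conv mK = {\<mu>\<in>bounded_radon. compact (csupport \<mu>) \<and>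
     (\<forall>f\<in>Cc. cintegral \<mu> (natural conv mK f) = cintegral \<mu> f)}"

text \<open>\<open>m\<close> is a left Haar measure of the hypergroup and \<open>mK\<close> the normalized Haar measure of \<open>K\<close>.\<close>

definition gelfand_pair ::
    "('a::t2_space cmeas \<Rightarrow> 'a cmeas \<Rightarrow> 'a cmeas) \<Rightarrow> 'a \<Rightarrow> ('a \<Rightarrow> 'a) \<Rightarrow> 'a set \<Rightarrow>
     'a measure \<Rightarrow> 'a measure \<Rightarrow> bool" where
  "gelfand_pair conv e dia K m mK \<longleftrightarrow>
     hypergroup conv e dia \<and> left_haar conv UNIV m \<and>
     subhypergroup conv dia K \<and> compact K \<and> left_haar conv K mK \<and> emeasure mK K = 1 \<and>
     (\<forall>\<mu>\<in>Mc_natural conv mK. \<forall>\<nu>\<in>Mc_natural conv mK. conv \<mu> \<nu> = conv \<nu> \<mu>)"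

section \<open>Dual space and Fourier transform\<close>

definition dual ::
    "('a::t2_space cmeas \<Rightarrow> 'a cmeas \<Rightarrow> 'a cmeas) \<Rightarrow> 'a \<Rightarrow> ('a \<Rightarrow> 'a) \<Rightarrow> 'a set \<Rightarrow> 'a measure \<Rightarrow>
     ('a \<Rightarrow> complex) set" where
  "dual conv e dia K mK = {\<phi>. bounded (range \<phi>) \<and> continuous_on UNIV \<phi> \<and> bi_invariant conv K \<phi> \<and>
     \<phi> e = 1 \<and> (\<forall>x y. (LINT k|mK. at3 conv \<phi> x k y) = \<phi> x * \<phi> y) \<and>
     (\<forall>x. \<phi> (dia x) = cnj (\<phi> x))}"

text \<open>The topology of uniform convergence on compact sets. As the functions are continuous, a
  pointwise strict bound on a compact set is a uniform one.\<close>

definition compact_convergence :: "('a::topological_space \<Rightarrow> complex) set \<Rightarrow> ('a \<Rightarrow> complex) topology" where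
  "compact_convergence D = topology_generated_by
     {{\<psi>\<in>D. \<forall>x\<in>C. dist (\<psi> x) (\<phi> x) < \<epsilon>} | \<phi> C \<epsilon>. \<phi> \<in> D \<and> compact C \<and> 0 < \<epsilon>}"

definition Lp :: "'x measure \<Rightarrow> real \<Rightarrow> ('x \<Rightarrow> 'b::real_normed_vector) set" where
  "Lp M p = {h\<in>borel_measurable M. (\<integral>\<^sup>+x. ennreal (norm (h x) powr p) \<partial>M) < \<infinity>}"

definition Lp_natural ::
    "('a::t2_space cmeas \<Rightarrow> 'a cmeas \<Rightarrow> 'a cmeas) \<Rightarrow> 'a set \<Rightarrow> 'a measure \<Rightarrow> real \<Rightarrow>
     ('a \<Rightarrow> complex) set" where
  "Lp_natural conv K m p = {f\<in>Lp m p. bi_invariant_AE conv K m f}"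

definition fourier :: "('a \<Rightarrow> 'a) \<Rightarrow> 'a measure \<Rightarrow> ('a \<Rightarrow> complex) \<Rightarrow> ('a \<Rightarrow> complex) \<Rightarrow> complex" where
  "fourier dia m f \<phi> = (LINT x|m. \<phi> (dia x) * f x)"

definition plancherel_measure ::
    "('a::t2_space cmeas \<Rightarrow> 'a cmeas \<Rightarrow> 'a cmeas) \<Rightarrow> 'a \<Rightarrow> ('a \<Rightarrow> 'a) \<Rightarrow> 'a set \<Rightarrow>
     'a measure \<Rightarrow> 'a measure \<Rightarrow> ('a \<Rightarrow> complex) measure \<Rightarrow> bool" where
  "plancherel_measure conv e dia K m mK \<pi> \<longleftrightarrow>
     radon_measure (compact_convergence (dual conv e dia K mK)) \<pi> \<and>
     (\<forall>f \<in> Lp_natural conv K m 1 \<inter> Lp_natural conv K m 2.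
        (\<integral>\<^sup>+x. ennreal ((norm (f x))\<^sup>2) \<partial>m) = (\<integral>\<^sup>+\<phi>. ennreal ((norm (fourier dia m f \<phi>))\<^sup>2) \<partial>\<pi>))"

text \<open>The Fourier transform on \<open>L\<^sup>2\<close> is the continuous extension of \<^const>\<open>fourier\<close> from
  \<open>L\<^sup>1 \<inter> L\<^sup>2\<close>. By Plancherel's theorem the limit \<open>g\<close> exists and is unique up to \<open>\<pi>\<close>-null sets;
  the definition picks one representative of its class.\<close>

definition fourier_L2 ::
    "('a::t2_space cmeas \<Rightarrow> 'a cmeas \<Rightarrow> 'a cmeas) \<Rightarrow> ('a \<Rightarrow> 'a) \<Rightarrow> 'a set \<Rightarrow>
     'a measure \<Rightarrow> ('a \<Rightarrow> complex) measure \<Rightarrow> ('a \<Rightarrow> complex) \<Rightarrow> ('a \<Rightarrow> complex) \<Rightarrow> complex" where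
  "fourier_L2 conv dia K m \<pi> f = (SOME g. g \<in> Lp \<pi> 2 \<and>
     (\<exists>F. (\<forall>n::nat. F n \<in> Lp_natural conv K m 1 \<inter> Lp_natural conv K m 2) \<and>
        (\<lambda>n. \<integral>\<^sup>+x. ennreal ((norm (F n x - f x))\<^sup>2) \<partial>m) \<longlonglongrightarrow> 0 \<and>
        (\<lambda>n. \<integral>\<^sup>+\<phi>. ennreal ((norm (fourier dia m (F n) \<phi> - g \<phi>))\<^sup>2) \<partial>\<pi>) \<longlonglongrightarrow> 0))"

definition inverse_fourier :: "('a \<Rightarrow> complex) measure \<Rightarrow> (('a \<Rightarrow> complex) \<Rightarrow> complex) \<Rightarrow> 'a \<Rightarrow> complex" where
  "inverse_fourier \<pi> g x = (LINT \<phi>|\<pi>. \<phi> x * g \<phi>)"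

text \<open>The representative of the class of \<open>f\<close> with which \<open>f\<close> is identified.\<close>

definition representative ::
    "('a::t2_space cmeas \<Rightarrow> 'a cmeas \<Rightarrow> 'a cmeas) \<Rightarrow> ('a \<Rightarrow> 'a) \<Rightarrow> 'a set \<Rightarrow>
     'a measure \<Rightarrow> ('a \<Rightarrow> complex) measure \<Rightarrow> ('a \<Rightarrow> complex) \<Rightarrow> 'a \<Rightarrow> complex" where
  "representative conv dia K m \<pi> f =
     (if fourier_L2 conv dia K m \<pi> f \<in> Lp \<pi> 1
      then inverse_fourier \<pi> (fourier_L2 conv dia K m \<pi> f) else f)"

section \<open>Sobolev spaces\<close>

text \<open>Measurability of the transform holds automatically by Plancherel's theorem; it is stated
  because the finiteness of the integral presupposes it.\<close>

definition sobolev ::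
    "('a::t2_space cmeas \<Rightarrow> 'a cmeas \<Rightarrow> 'a cmeas) \<Rightarrow> ('a \<Rightarrow> 'a) \<Rightarrow> 'a set \<Rightarrow>
     'a measure \<Rightarrow> ('a \<Rightarrow> complex) measure \<Rightarrow> (('a \<Rightarrow> complex) \<Rightarrow> real) \<Rightarrow> real \<Rightarrow> ('a \<Rightarrow> complex) set" where
  "sobolev conv dia K m \<pi> \<gamma> s = {f \<in> Lp_natural conv K m 2.
     fourier_L2 conv dia K m \<pi> f \<in> borel_measurable \<pi> \<and>
     (\<integral>\<^sup>+\<phi>. ennreal ((1 + (\<gamma> \<phi>)\<^sup>2) powr s * (norm (fourier_L2 conv dia K m \<pi> f \<phi>))\<^sup>2) \<partial>\<pi>) < \<infinity>}"

definition sobolev_norm ::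
    "('a::t2_space cmeas \<Rightarrow> 'a cmeas \<Rightarrow> 'a cmeas) \<Rightarrow> ('a \<Rightarrow> 'a) \<Rightarrow> 'a set \<Rightarrow>
     'a measure \<Rightarrow> ('a \<Rightarrow> complex) measure \<Rightarrow> (('a \<Rightarrow> complex) \<Rightarrow> real) \<Rightarrow> real \<Rightarrow> ('a \<Rightarrow> complex) \<Rightarrow> real" where
  "sobolev_norm conv dia K m \<pi> \<gamma> s f =
     sqrt (LINT \<phi>|\<pi>. (1 + (\<gamma> \<phi>)\<^sup>2) powr s * (norm (fourier_L2 conv dia K m \<pi> f \<phi>))\<^sup>2)"

text \<open>The supremum norm, with value \<open>\<infinity>\<close> for unbounded functions.\<close>

definition sup_norm :: "('a \<Rightarrow> complex) \<Rightarrow> ennreal" where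
  "sup_norm f = (SUP x. ennreal (norm (f x)))"

definition uniformly_bounded :: "('a \<Rightarrow> complex) set \<Rightarrow> bool" where
  "uniformly_bounded D \<longleftrightarrow> (\<exists>M::real. \<forall>\<phi>\<in>D. \<forall>x. norm (\<phi> x) \<le> M)"

end

theory Submission
  imports Defs
begin

text \<open>Write \<open>w\<close> for 1 + \<gamma>^2 and \<open>g\<close> for the Fourier transform
  of \<open>f\<close>. Splitting |g| as w^(-s/2) times w^(s/2) |g|, Cauchy-Schwarz
  (\<open>Cauchy_Schwarz_integral\<close>) bounds the L^1 norm of \<open>g\<close> by sqrt A times
  the Sobolev norm of \<open>f\<close>, where \<open>A\<close>, the integral of w^(-s), is finite by
  the assumption on 1/(1 + \<gamma>^2). So \<open>g\<close> is integrable and \<open>f\<close> is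
  given pointwise by the inversion formula. There every \<phi> x is bounded by one constant
  \<open>B\<close>, hence |f(x)| is at most \<open>B\<close> times the L^1 norm of \<open>g\<close>
  (\<open>norm_integral_mult_le\<close>), uniformly in \<open>x\<close>.\<close>

lemma Cauchy_Schwarz_integral:
  fixes f g :: "'x \<Rightarrow> real"
  assumes [measurable]: "f \<in> borel_measurable M" "g \<in> borel_measurable M"
    and f2: "integrable M (\<lambda>x. (f x)\<^sup>2)" and g2: "integrable M (\<lambda>x. (g x)\<^sup>2)"
  shows "integrable M (\<lambda>x. f x * g x)"
    and "(LINT x|M. \<bar>f x * g x\<bar>) \<le> sqrt (LINT x|M. (f x)\<^sup>2) * sqrt (LINT x|M. (g x)\<^sup>2)"
proof -
  let ?a = "LINT x|M. (f x)\<^sup>2" and ?b = "LINT x|M. \<bar>f x * g x\<bar>" and ?c = "LINT x|M. (g x)\<^sup>2"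
  have sq: "(\<integral>\<^sup>+x. ennreal \<bar>h x\<bar> ^ 2 \<partial>M) = ennreal (LINT x|M. (h x)\<^sup>2)"
    if "integrable M (\<lambda>x. (h x)\<^sup>2)" for h :: "'x \<Rightarrow> real"
    using nn_integral_eq_integral[OF that] by (simp add: ennreal_power)
  \<comment> \<open>The inequality for nonnegative integrals presupposes no integrability, so its
    finite right-hand side yields integrability of the product; only then can it be read as an
    inequality of reals.\<close>
  have CS: "(\<integral>\<^sup>+x. ennreal \<bar>f x * g x\<bar> \<partial>M)\<^sup>2 \<le> ennreal (?a * ?c)"
    using Cauchy_Schwarz_nn_integral[of "\<lambda>x. ennreal \<bar>f x\<bar>" M "\<lambda>x. ennreal \<bar>g x\<bar>"]
    by (simp add: sq f2 g2 abs_mult ennreal_mult)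
  also have "\<dots> < \<infinity>"
    by simp
  finally have "(\<integral>\<^sup>+x. ennreal \<bar>f x * g x\<bar> \<partial>M) < \<infinity>"
    by (simp add: power_less_top_ennreal)
  then show int: "integrable M (\<lambda>x. f x * g x)"
    by (simp add: integrable_iff_bounded)
  have "(\<integral>\<^sup>+x. ennreal \<bar>f x * g x\<bar> \<partial>M) = ennreal ?b"
    using int by (intro nn_integral_eq_integral) auto
  with CS have "?b\<^sup>2 \<le> ?a * ?c"
    by (simp add: ennreal_power)
  then show "?b \<le> sqrt ?a * sqrt ?c"
    by (simp add: real_le_rsqrt flip: real_sqrt_mult)
qed

text \<open>The uniform bound is known on the dual only, whereas integral estimates require it on
  all of \<open>space \<pi>\<close>. The inclusion holds because every generating set of the
  topology lies in \<open>D\<close>.\<close>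

lemma space_radon_measure_subset:
  assumes "radon_measure (compact_convergence D) \<pi>"
  shows "space \<pi> \<subseteq> D"
proof -
  have "space \<pi> = space (borel_of (compact_convergence D))"
    using assms by (intro sets_eq_imp_space_eq) (simp add: radon_measure_def)
  also have "\<dots> = topspace (compact_convergence D)"
    using openin_subset by (auto simp: borel_of_def intro!: space_measure_of)
  also have "\<dots> \<subseteq> D"
    by (auto simp: compact_convergence_def)
  finally show ?thesis .
qed

text \<open>The integral on the left is the junk value \<open>0\<close> when the product is not integrable.\<close>

lemma norm_integral_mult_le:
  fixes g h :: "'x \<Rightarrow> complex"
  assumes g: "integrable M g" and h: "\<And>x. x \<in> space M \<Longrightarrow> norm (h x) \<le> B" and "0 \<le> B"
  shows "norm (LINT x|M. h x * g x) \<le> B * (LINT x|M. norm (g x))"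
proof (cases "integrable M (\<lambda>x. h x * g x)")
  case True
  have "norm (LINT x|M. h x * g x) \<le> (LINT x|M. norm (h x * g x))"
    by simp
  also have "\<dots> \<le> (LINT x|M. B * norm (g x))"
    using integrable_norm[OF True] g h
    by (intro integral_mono) (auto simp: norm_mult intro!: mult_right_mono)
  finally show ?thesis by simp
next
  case False
  then show ?thesis
    using \<open>0 \<le> B\<close> by (simp add: not_integrable_integral_eq)
qed

theorem theorem3p7:
  fixes conv :: "'a::t2_space cmeas \<Rightarrow> 'a cmeas \<Rightarrow> 'a cmeas"
    and e :: 'a and dia :: "'a \<Rightarrow> 'a" and K :: "'a set"
    and m mK :: "'a measure" and \<pi> :: "('a \<Rightarrow> complex) measure"
    and \<gamma> :: "('a \<Rightarrow> complex) \<Rightarrow> real" and s :: real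
  assumes "gelfand_pair conv e dia K m mK"
    and "plancherel_measure conv e dia K m mK \<pi>"
    and "\<gamma> \<in> borel_measurable (borel_of (compact_convergence (dual conv e dia K mK)))"
    and "\<And>\<phi>. \<phi> \<in> dual conv e dia K mK \<Longrightarrow> 0 \<le> \<gamma> \<phi>"
    and "0 < s"
    and "uniformly_bounded (dual conv e dia K mK)"
    and "(\<lambda>\<phi>. 1 / (1 + (\<gamma> \<phi>)\<^sup>2)) \<in> Lp \<pi> s"
  shows "\<exists>C>0. \<forall>f\<in>sobolev conv dia K m \<pi> \<gamma> s.
           sup_norm (representative conv dia K m \<pi> f) \<le> ennreal (C * sobolev_norm conv dia K m \<pi> \<gamma> s f)"
proof -
  let ?D = "dual conv e dia K mK"
  have radon: "radon_measure (compact_convergence ?D) \<pi>"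
    using assms(2) by (simp add: plancherel_measure_def)
  have [measurable]: "\<gamma> \<in> borel_measurable \<pi>"
    using assms(3) radon by (simp add: radon_measure_def cong: measurable_cong_sets)
  obtain M where M: "\<And>\<phi> x. \<phi> \<in> ?D \<Longrightarrow> norm (\<phi> x) \<le> M"
    using assms(6) by (auto simp: uniformly_bounded_def)
  \<comment> \<open>If the dual is empty, \<open>M\<close> may be negative; the maximum keeps
    \<open>B\<close> positive, as the final constant must be.\<close>
  define B where "B = max M 1"
  have B: "norm (\<phi> x) \<le> B" if "\<phi> \<in> space \<pi>" for \<phi> x
    using M[of \<phi> x] that space_radon_measure_subset[OF radon] by (auto simp: B_def)
  define w where "w = (\<lambda>\<phi>. 1 + (\<gamma> \<phi>)\<^sup>2)"
  have w_eq: "1 + (\<gamma> \<phi>)\<^sup>2 = w \<phi>" for \<phi>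
    by (simp add: w_def)
  have w: "0 < w \<phi>" for \<phi>
    using zero_le_power2[of "\<gamma> \<phi>"] unfolding w_def by linarith
  have [measurable]: "w \<in> borel_measurable \<pi>"
    unfolding w_def by measurable
  have sq: "(w \<phi> powr (t / 2))\<^sup>2 = w \<phi> powr t" for \<phi> t
    by (simp add: power2_eq_square flip: powr_add)
  \<comment> \<open>Membership of 1/w in L^s is finiteness of this integral, since (1/w)^s =
    w^(-s).\<close>
  have "(\<integral>\<^sup>+\<phi>. ennreal (w \<phi> powr - s) \<partial>\<pi>) < \<infinity>"
    using assms(7) w by (simp add: Lp_def w_def powr_minus powr_divide divide_inverse inverse_powr)
  then have w_int: "integrable \<pi> (\<lambda>\<phi>. w \<phi> powr - s)"
    by (intro integrableI_nonneg) auto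
  define A where "A = (LINT \<phi>|\<pi>. w \<phi> powr - s)"
  have "0 \<le> A"
    by (simp add: A_def)
  have bound: "norm (representative conv dia K m \<pi> f x)
      \<le> B * (sqrt A * sobolev_norm conv dia K m \<pi> \<gamma> s f)"
    if f: "f \<in> sobolev conv dia K m \<pi> \<gamma> s" for f x
  proof -
    define g where "g = fourier_L2 conv dia K m \<pi> f"
    have [measurable]: "g \<in> borel_measurable \<pi>"
      using f by (simp add: sobolev_def g_def)
    have g_sq: "(w \<phi> powr (s / 2) * norm (g \<phi>))\<^sup>2 = w \<phi> powr s * (norm (g \<phi>))\<^sup>2" for \<phi>
      by (simp add: power_mult_distrib sq)
    have "(\<integral>\<^sup>+\<phi>. ennreal (w \<phi> powr s * (norm (g \<phi>))\<^sup>2) \<partial>\<pi>) < \<infinity>"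
      using f by (simp add: sobolev_def g_def w_def)
    then have g_int: "integrable \<pi> (\<lambda>\<phi>. w \<phi> powr s * (norm (g \<phi>))\<^sup>2)"
      by (intro integrableI_nonneg) auto
    \<comment> \<open>The squares of the two factors are the integrands of \<open>A\<close> and of
      the squared Sobolev norm. Cancelling the weights uses \<open>0 < w \<phi>\<close>, as
      \<open>0 powr 0\<close> is 0.\<close>
    have split: "w \<phi> powr (- s / 2) * (w \<phi> powr (s / 2) * norm (g \<phi>)) = norm (g \<phi>)" for \<phi>
      using w[of \<phi>] by (simp flip: mult.assoc powr_add)
    note CS = Cauchy_Schwarz_integral[of "\<lambda>\<phi>. w \<phi> powr (- s / 2)" \<pi>
        "\<lambda>\<phi>. w \<phi> powr (s / 2) * norm (g \<phi>)", unfolded sq g_sq split]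
    have "integrable \<pi> (\<lambda>\<phi>. norm (g \<phi>))"
      by (rule CS) (use w_int g_int in measurable)
    then have g1: "integrable \<pi> g"
      by (simp add: integrable_norm_iff)
    have norm_g: "(LINT \<phi>|\<pi>. norm (g \<phi>)) \<le> sqrt A * sobolev_norm conv dia K m \<pi> \<gamma> s f"
      using CS(2)[OF _ _ w_int g_int]
      by (simp add: A_def sobolev_norm_def w_eq flip: g_def)
    \<comment> \<open>This selects the branch of \<open>representative\<close> given by the
      inversion integral.\<close>
    have "g \<in> Lp \<pi> 1"
      using g1 by (simp add: Lp_def integrable_iff_bounded)
    then have "representative conv dia K m \<pi> f x = (LINT \<phi>|\<pi>. \<phi> x * g \<phi>)"
      by (simp add: representative_def inverse_fourier_def g_def)
    \<comment> \<open>Measurability of \<phi> \<mapsto> \<phi> x need not be checked: the lemma also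
      covers a non-integrable product.\<close>
    also have "norm \<dots> \<le> B * (LINT \<phi>|\<pi>. norm (g \<phi>))"
      by (rule norm_integral_mult_le[OF g1 B]) (auto simp: B_def)
    also have "\<dots> \<le> B * (sqrt A * sobolev_norm conv dia K m \<pi> \<gamma> s f)"
      using norm_g by (intro mult_left_mono) (auto simp: B_def)
    finally show ?thesis .
  qed
  have nonneg: "0 \<le> sobolev_norm conv dia K m \<pi> \<gamma> s f" for f
    by (simp add: sobolev_norm_def)
  \<comment> \<open>\<open>A\<close> may vanish (if \<open>\<pi> = 0\<close>), and the constant has to be positive.\<close>
  define C where "C = B * (sqrt A + 1)"
  have "0 < C"
    using \<open>0 \<le> A\<close> by (simp add: C_def B_def add_nonneg_pos)
  moreover have "sup_norm (representative conv dia K m \<pi> f)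
      \<le> ennreal (C * sobolev_norm conv dia K m \<pi> \<gamma> s f)"
    if "f \<in> sobolev conv dia K m \<pi> \<gamma> s" for f
    unfolding sup_norm_def
  proof (intro SUP_least ennreal_leI)
    fix x
    have "B * (sqrt A * sobolev_norm conv dia K m \<pi> \<gamma> s f)
        \<le> B * ((sqrt A + 1) * sobolev_norm conv dia K m \<pi> \<gamma> s f)"
      using nonneg by (intro mult_left_mono mult_right_mono) (auto simp: B_def)
    with bound[OF that, of x] show "norm (representative conv dia K m \<pi> f x)
        \<le> C * sobolev_norm conv dia K m \<pi> \<gamma> s f"
      by (simp add: C_def mult.assoc)
  qed
  ultimately show ?thesis by blast
qed

end
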